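(* Let $p$ be a prime and let $S\subseteq\mathbb{Z}_{p^2}$ be a generating set of the additive group $\mathbb{Z}_{p^2}$ with $S=-S$ and $0\notin S$. If $|S|<p$ and $xp\notin S$ for all $x\in\mathbb{Z}_p\setminus\{0\}$, then $O\chi(\Gamma(\mathbb{Z}_{p^2},S))=p$.
   Context: For an additive group $G$ and a subset $S\subseteq G$ closed under negation with $0\notin S$, the Cayley graph $\Gamma(G,S)$ has vertex set $G$, with $u$ and $v$ adjacent if and only if $u-v\in S$. All colourings are proper vertex colourings. Two colourings of a graph are orthogonal if whenever two distinct vertices receive the same colour in one colouring, they receive distinct colours in the other. An orthogonal colouring is a pair of orthogonal proper colourings; $O\chi(G)$ is the minimum number of colours needed for an orthogonal colouring of $G$ (both colourings drawing from the same set of that many colours). *)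

theory Defs
  imports
    "HOL-Computational_Algebra.Primes"
    "HOL-Algebra.Elementary_Groups"
    "HOL-Algebra.Generated_Groups"
    "Graph_Theory.Pair_Digraph"
begin

text \<open>
  Graphs are symmetric loopless relations (\<^locale>\<open>pair_graph\<close> when finite), so an edge
  between u and v is the two arcs (u, v) and (v, u). Groups of HOL-Algebra are written
  multiplicatively: \<open>u \<otimes> inv v\<close> is u - v in an additive group.
\<close>

definition cayley_graph :: "('a, 'b) monoid_scheme \<Rightarrow> 'a set \<Rightarrow> 'a pair_pre_digraph" where
  "cayley_graph G S =
     \<lparr> pverts = carrier G,
       parcs = {(u, v). u \<in> carrier G \<and> v \<in> carrier G \<and> u \<otimes>\<^bsub>G\<^esub> inv\<^bsub>G\<^esub> v \<in> S} \<rparr>"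

lemma (in group) pair_graph_cayley_graph:
  assumes "finite (carrier G)" "S \<subseteq> carrier G" "set_inv S = S" "\<one> \<notin> S"
  shows "pair_graph (cayley_graph G S)"
proof
  let ?A = "{(u, v). u \<in> carrier G \<and> v \<in> carrier G \<and> u \<otimes> inv v \<in> S}"
  have "?A \<subseteq> carrier G \<times> carrier G" by auto
  then show "finite (parcs (cayley_graph G S))"
    using assms(1) by (auto simp: cayley_graph_def intro: finite_subset)
  have "v \<otimes> inv u \<in> S" if "u \<in> carrier G" "v \<in> carrier G" "u \<otimes> inv v \<in> S" for u v
  proof -
    have "inv (u \<otimes> inv v) \<in> S"
      using that(3) assms(3) by (auto simp: SET_INV_def)
    then show ?thesis using that by (simp add: inv_mult_group)
  qed
  then show "symmetric (with_proj (cayley_graph G S))"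
    by (simp add: symmetric_def cayley_graph_def sym_def)
qed (use assms(1,4) in \<open>auto simp: cayley_graph_def\<close>)

definition proper_colouring :: "'v pair_pre_digraph \<Rightarrow> 'c set \<Rightarrow> ('v \<Rightarrow> 'c) \<Rightarrow> bool" where
  "proper_colouring \<Gamma> C f \<longleftrightarrow>
     f ` pverts \<Gamma> \<subseteq> C \<and> (\<forall>(u, v) \<in> parcs \<Gamma>. f u \<noteq> f v)"

definition orthogonal :: "'v pair_pre_digraph \<Rightarrow> ('v \<Rightarrow> 'c) \<Rightarrow> ('v \<Rightarrow> 'c) \<Rightarrow> bool" where
  "orthogonal \<Gamma> f g \<longleftrightarrow>
     (\<forall>u \<in> pverts \<Gamma>. \<forall>v \<in> pverts \<Gamma>. u \<noteq> v \<longrightarrow>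
        (f u = f v \<longrightarrow> g u \<noteq> g v) \<and> (g u = g v \<longrightarrow> f u \<noteq> f v))"

definition orthogonal_colouring ::
    "'v pair_pre_digraph \<Rightarrow> 'c set \<Rightarrow> ('v \<Rightarrow> 'c) \<times> ('v \<Rightarrow> 'c) \<Rightarrow> bool" where
  "orthogonal_colouring \<Gamma> C = (\<lambda>(f, g).
     proper_colouring \<Gamma> C f \<and> proper_colouring \<Gamma> C g \<and> orthogonal \<Gamma> f g)"

text \<open>Meaningful for finite loopless graphs, for which the minimum exists by the lemma below.\<close>

definition orthogonal_chromatic_number :: "'v pair_pre_digraph \<Rightarrow> nat" where
  "orthogonal_chromatic_number \<Gamma> =
     (LEAST k. \<exists>fg. orthogonal_colouring \<Gamma> {..<k} fg)"

lemma (in pair_graph) orthogonal_colouring_exists: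
  "\<exists>k fg. orthogonal_colouring G {..<k::nat} fg"
proof -
  obtain h :: "'a \<Rightarrow> nat" and n where h: "h ` pverts G = {i. i < n}" "inj_on h (pverts G)"
    using finite_imp_inj_to_nat_seg[OF pair_finite_verts] by blast
  have "h u \<noteq> h v" if "(u, v) \<in> parcs G" for u v
    using inj_onD[OF h(2) _ in_arcsD1[OF that] in_arcsD2[OF that]] pair_no_loops[OF that] by auto
  then have "proper_colouring G {..<n} h"
    using h(1) by (auto simp: proper_colouring_def)
  moreover have "orthogonal G h h"
    using h(2) by (auto simp: orthogonal_def inj_on_def)
  ultimately have "orthogonal_colouring G {..<n} (h, h)"
    by (simp add: orthogonal_colouring_def)
  then show ?thesis by blast
qed

end

theory Submission
  imports Defs
begin

text \<open>
  Since \<open>S\<close> contains no multiple of \<open>p\<close>, reduction mod \<open>p\<close> is a proper colouring; its classes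
  are the cosets of \<open>p\<int>\<close>. For every \<open>c\<close>, the colouring \<open>x \<mapsto> \<lfloor>x / p\<rfloor> + c x\<close> mod \<open>p\<close> is
  orthogonal to it. It is proper as soon as \<open>\<lfloor>s / p\<rfloor> + c s\<close> is nonzero mod \<open>p\<close> for all
  \<open>s \<in> S\<close>: adding \<open>s\<close> changes the colour by this value, possibly plus a carry 1, and the case
  with a carry is the condition for \<open>- s\<close>. Each \<open>s\<close> excludes exactly one \<open>c\<close> mod \<open>p\<close>, and
  \<open>|S| < p\<close>. Conversely, orthogonality makes the pair of colours injective, so \<open>k\<close> colours
  handle at most \<open>k\<^sup>2\<close> vertices.
\<close>

lemma orthogonal_colouring_card_le:
  assumes "orthogonal_colouring \<Gamma> C fg" "finite C"
  shows "card (pverts \<Gamma>) \<le> (card C)\<^sup>2"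
proof -
  obtain f g where fg: "fg = (f, g)" by force
  let ?h = "\<lambda>v. (f v, g v)"
  have "orthogonal \<Gamma> f g"
    using assms(1) by (simp add: fg orthogonal_colouring_def)
  then have "inj_on ?h (pverts \<Gamma>)"
    unfolding orthogonal_def inj_on_def by blast
  moreover have "?h ` pverts \<Gamma> \<subseteq> C \<times> C"
    using assms(1) by (auto simp: fg orthogonal_colouring_def proper_colouring_def)
  ultimately have "card (pverts \<Gamma>) \<le> card (C \<times> C)"
    using card_inj_on_le assms(2) by blast
  then show ?thesis by (simp add: power2_eq_square card_cartesian_product)
qed

text \<open>A pigeonhole count: \<open>h\<close> picks for each bad residue \<open>c\<close> in
  \<open>B\<close> some \<open>s\<close> that rules it out. One \<open>s\<close> cannot rule out two
  residues, because \<open>s\<close> is invertible modulo the prime \<open>p\<close>. Hence at most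
  \<open>card S < p\<close> of the \<open>p\<close> residues are bad.\<close>

lemma exists_multiplier_avoiding:
  fixes p :: nat and S :: "int set" and b :: "int \<Rightarrow> int"
  assumes "prime p" "finite S" "card S < p" "\<And>s. s \<in> S \<Longrightarrow> \<not> int p dvd s"
  obtains c where "\<And>s. s \<in> S \<Longrightarrow> \<not> int p dvd b s + c * s"
proof -
  define B where "B = {c \<in> {0..<int p}. \<exists>s \<in> S. int p dvd b s + c * s}"
  have "\<forall>c \<in> B. \<exists>s \<in> S. int p dvd b s + c * s"
    by (auto simp: B_def)
  then obtain h where h: "\<And>c. c \<in> B \<Longrightarrow> h c \<in> S \<and> int p dvd b (h c) + c * h c"
    by metis
  have "inj_on h B"
  proof (rule inj_onI)
    fix c d assume cd: "c \<in> B" "d \<in> B" "h c = h d"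
    have "int p dvd (b (h c) + c * h c) - (b (h c) + d * h c)"
      using h[OF cd(1)] h[OF cd(2)] cd(3) by (metis dvd_diff)
    then have "int p dvd (c - d) * h c"
      by (simp add: algebra_simps)
    moreover have "\<not> int p dvd h c"
      using h[OF cd(1)] assms(4) by blast
    ultimately have "int p dvd c - d"
      using assms(1) by (simp add: prime_dvd_mult_iff)
    then have "c mod int p = d mod int p"
      by (simp add: mod_eq_dvd_iff)
    then show "c = d" using cd(1,2) by (simp add: B_def)
  qed
  then have "card B \<le> card S"
    using h assms(2) by (intro card_inj_on_le) auto
  then have "B \<noteq> {0..<int p}" using assms(3) by auto
  then show thesis using that by (auto simp: B_def)
qed

lemma div_plus_mult_not_cong:
  fixes p c u v :: int
  assumes "p > 0" "\<not> p dvd u - v"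
    and pos: "\<not> p dvd (u - v) div p + c * (u - v)"
    and neg: "\<not> p dvd (v - u) div p + c * (v - u)"
  shows "(u div p + c * u) mod p \<noteq> (v div p + c * v) mod p"
proof
  assume "(u div p + c * u) mod p = (v div p + c * v) mod p"
  then have d: "p dvd (u div p + c * u) - (v div p + c * v)"
    by (simp add: mod_eq_dvd_iff)
  define s where "s = u - v"
  \<comment> \<open>\<open>r div p\<close> is the carry when \<open>v\<close> and \<open>s\<close>
    are added in base \<open>p\<close>; as a sum of two remainders, \<open>r\<close> is below
    \<open>p + p\<close>, so the carry is 0 or 1.\<close>
  define r where "r = v mod p + s mod p"
  have "u div p = (v + s) div p" by (simp add: s_def)
  also have "\<dots> = v div p + s div p + r div p"
    unfolding r_def by (rule div_add1_eq)
  finally have u: "u div p = v div p + s div p + r div p" .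
  have "0 \<le> r" "r < p + p"
    using assms(1) pos_mod_sign[of p v] pos_mod_sign[of p s] pos_mod_bound[of p v] pos_mod_bound[of p s]
    unfolding r_def by linarith+
  then have "r div p = 0 \<or> r div p = 1"
    using assms(1) by (cases "r < p") (simp_all add: div_pos_geq)
  then show False
  proof
    assume "r div p = 0"
    then have "(u div p + c * u) - (v div p + c * v) = (u - v) div p + c * (u - v)"
      using u by (simp add: s_def algebra_simps)
    then show False using d pos by simp
  next
    assume "r div p = 1"
    \<comment> \<open>Since \<open>p\<close> does not divide \<open>s\<close>, rounding down costs
      an extra 1 on negation; this is exactly what absorbs the carry.\<close>
    moreover have "(v - u) div p = - (s div p) - 1"
      using assms(2) zdiv_zminus1_eq_if[of p s] assms(1)
      by (auto simp: s_def dvd_eq_mod_eq_0)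
    ultimately have "(u div p + c * u) - (v div p + c * v) = - ((v - u) div p + c * (v - u))"
      using u by (simp add: s_def algebra_simps)
    then show False using d neg by (metis dvd_minus_iff)
  qed
qed

text \<open>Adding p * (p * q) to a number changes its quotient by p * q and its multiple by
  \<open>c\<close> by a multiple of \<open>p\<close>. This lets a condition on the representatives
  in \<open>S\<close> be applied to the integer differences \<open>u - v\<close> and
  \<open>v - u\<close>.\<close>

lemma dvd_div_plus_mult_mod_square:
  fixes p c x :: int
  assumes "p \<noteq> 0"
  shows "p dvd (x mod p\<^sup>2) div p + c * (x mod p\<^sup>2) \<longleftrightarrow> p dvd x div p + c * x"
proof -
  define q where "q = x div p\<^sup>2"
  define r where "r = x mod p\<^sup>2"
  have x: "x = r + p * (p * q)"
    by (simp add: q_def r_def flip: power2_eq_square mult.assoc)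
  have "x div p + c * x = (r div p + c * r) + p * (q + c * (p * q))"
    unfolding x using assms by (simp add: algebra_simps)
  then show ?thesis
    unfolding r_def[symmetric] by (simp add: dvd_add_left_iff)
qed

lemma orthogonal_colouring_cayley_graph_square:
  fixes p :: nat and S :: "int set"
  defines "G \<equiv> integer_mod_group (p\<^sup>2)"
  assumes "prime p" "S \<subseteq> carrier G" "S = set_inv\<^bsub>G\<^esub> S" "card S < p"
    and nd: "\<And>s. s \<in> S \<Longrightarrow> \<not> int p dvd s"
  shows "\<exists>fg. orthogonal_colouring (cayley_graph G S) {..<p} fg"
proof -
  have p: "p > 0" using assms(2) by (simp add: prime_gt_0_nat)
  have carrier: "carrier G = {0..<(int p)\<^sup>2}"
    using p by (simp add: G_def carrier_integer_mod_group)
  have "finite S" using assms(3) carrier finite_subset by auto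
  then obtain c where c: "\<And>s. s \<in> S \<Longrightarrow> \<not> int p dvd s div int p + c * s"
    using exists_multiplier_avoiding[of p S "\<lambda>s. s div int p"] assms(2,5) nd by blast
  define f where "f x = nat (x mod int p)" for x :: int
  define g where "g x = nat ((x div int p + c * x) mod int p)" for x :: int
  have f_eq: "f x = f y \<longleftrightarrow> x mod int p = y mod int p" for x y
    using p by (simp add: f_def nat_eq_iff)
  have g_eq: "g x = g y \<longleftrightarrow> (x div int p + c * x) mod int p = (y div int p + c * y) mod int p" for x y
    using p by (simp add: g_def nat_eq_iff)
  have range: "f x < p" "g x < p" for x
    using p by (simp_all add: f_def g_def nat_less_iff)
  have diff: "u \<otimes>\<^bsub>G\<^esub> inv\<^bsub>G\<^esub> v = (u - v) mod (int p)\<^sup>2" if "u \<in> carrier G" "v \<in> carrier G" for u v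
    using that by (simp add: G_def mod_simps)
  have mod_carrier: "x mod (int p)\<^sup>2 \<in> carrier G" for x
    using p by (simp add: carrier)
  have edge: "f u \<noteq> f v \<and> g u \<noteq> g v"
    if "u \<in> carrier G" "v \<in> carrier G" "u \<otimes>\<^bsub>G\<^esub> inv\<^bsub>G\<^esub> v \<in> S" for u v
  proof -
    have s: "(u - v) mod (int p)\<^sup>2 \<in> S"
      using that diff by simp
    have "inv\<^bsub>G\<^esub> ((u - v) mod (int p)\<^sup>2) \<in> S"
      using s assms(4) by (auto simp: SET_INV_def)
    then have t: "(v - u) mod (int p)\<^sup>2 \<in> S"
      using inv_integer_mod_group[OF mod_carrier[unfolded G_def]] by (simp add: G_def mod_minus_eq)
    have "int p dvd (int p)\<^sup>2" by simp
    then have "\<not> int p dvd u - v"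
      using nd[OF s] by (simp add: dvd_mod_iff)
    then show ?thesis
      using c[OF s] c[OF t] p div_plus_mult_not_cong[of "int p" u v c]
      by (simp add: dvd_div_plus_mult_mod_square f_eq g_eq mod_eq_dvd_iff)
  qed
  have orth: "u = v" if "u \<in> carrier G" "v \<in> carrier G" "f u = f v" "g u = g v" for u v
  proof -
    have "int p dvd u - v"
      using that(3) by (simp add: f_eq mod_eq_dvd_iff)
    moreover have "int p dvd (u div int p + c * u) - (v div int p + c * v)"
      using that(4) by (simp add: g_eq mod_eq_dvd_iff)
    \<comment> \<open>Equal \<open>f\<close>-colours make the term with \<open>c\<close> vanish
      modulo \<open>p\<close>, so equal \<open>g\<close>-colours compare the quotients
      alone.\<close>
    ultimately have "int p dvd ((u div int p + c * u) - (v div int p + c * v)) - c * (u - v)"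
      using dvd_diff dvd_mult by blast
    then have "int p dvd u div int p - v div int p"
      by (simp add: algebra_simps)
    then have "(u div int p) mod int p = (v div int p) mod int p"
      by (simp add: mod_eq_dvd_iff)
    \<comment> \<open>Vertices lie below p * p, so their quotients are already reduced modulo
      \<open>p\<close> and congruent ones are equal.\<close>
    moreover have "0 \<le> x div int p \<and> x div int p < int p" if "x \<in> carrier G" for x
    proof -
      have x: "0 \<le> x" "x < int p * int p"
        using that by (simp_all add: carrier power2_eq_square)
      have "int p * (x div int p) \<le> x"
        using p by (simp flip: minus_mod_eq_mult_div)
      then have "int p * (x div int p) < int p * int p"
        using x(2) by (rule le_less_trans)
      then show ?thesis
        using x(1) p by (simp add: pos_imp_zdiv_nonneg_iff)
    qed
    ultimately have "u div int p = v div int p"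
      using that by simp
    then show ?thesis
      using that(3) f_eq by (metis mult_div_mod_eq)
  qed
  have "orthogonal_colouring (cayley_graph G S) {..<p} (f, g)"
    unfolding orthogonal_colouring_def proper_colouring_def orthogonal_def cayley_graph_def
    using edge orth range by auto
  then show ?thesis by blast
qed

theorem theorem10:
  fixes p :: nat and S :: "int set"
  assumes "prime p"
    and "S \<subseteq> carrier (integer_mod_group (p\<^sup>2))"
    and "generate (integer_mod_group (p\<^sup>2)) S = carrier (integer_mod_group (p\<^sup>2))"
    and "S = set_inv\<^bsub>integer_mod_group (p\<^sup>2)\<^esub> S"
    and "0 \<notin> S"
    and "card S < p"
    and "\<forall>x \<in> carrier (integer_mod_group p) - {0}. x * int p \<notin> S"
  shows "orthogonal_chromatic_number (cayley_graph (integer_mod_group (p\<^sup>2)) S) = p"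
proof -
  let ?\<Gamma> = "cayley_graph (integer_mod_group (p\<^sup>2)) S"
  have p: "p > 0" using assms(1) by (simp add: prime_gt_0_nat)
  \<comment> \<open>A multiple of \<open>p\<close> in \<open>S\<close> would be
    \<open>x * int p\<close> with 0 < x < p, because \<open>s\<close> is nonzero and below p * p;
    these are the excluded elements.\<close>
  have "\<not> int p dvd s" if "s \<in> S" for s
  proof
    assume "int p dvd s"
    then obtain x where x: "s = x * int p" by (metis dvd_div_mult_self)
    moreover have "0 \<le> s" "s < int p * int p" "s \<noteq> 0"
      using that assms(2,5) p by (auto simp: carrier_integer_mod_group power2_eq_square)
    ultimately have "0 \<le> x" "x < int p" "x \<noteq> 0"
      using p by (auto simp: zero_le_mult_iff)
    then show False
      using assms(7) that p x by (auto simp: carrier_integer_mod_group)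
  qed
  then have "\<exists>fg. orthogonal_colouring ?\<Gamma> {..<p} fg"
    using orthogonal_colouring_cayley_graph_square assms(1,2,4,6) by blast
  moreover have "p \<le> k" if "\<exists>fg. orthogonal_colouring ?\<Gamma> {..<k} fg" for k
  proof -
    have "card (pverts ?\<Gamma>) = p\<^sup>2"
      using p by (simp add: cayley_graph_def carrier_integer_mod_group flip: of_nat_power)
    then have "p\<^sup>2 \<le> k\<^sup>2"
      using that orthogonal_colouring_card_le[of ?\<Gamma> "{..<k}"] by auto
    then show ?thesis by (simp add: power2_nat_le_eq_le)
  qed
  ultimately show ?thesis
    unfolding orthogonal_chromatic_number_def by (rule Least_equality)
qed

end
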